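(* Let $n\ge1$ and let $F=F_{d,r}$ (a polynomial in $n$ variables) for some integers $d,r\ge1$. Then: (1) $\frac{\partial F}{\partial x_i}\ge0$ on $[0,\infty)^n$ for all $i$. (2) For all $x\in[0,\infty)^n$ and all $i,j$ such that $x_i\ge x_j$, $$\begin{vmatrix}1&1\\ \frac{\partial F}{\partial x_i}(x)&\frac{\partial F}{\partial x_j}(x)\end{vmatrix}\ge0 .$$ (3) Whenever $1\le i,j,k\le n$ and $x\in[0,\infty)^n$ is such that $x_i\ge x_j\ge x_k>0$, $$\begin{vmatrix}\frac{\partial F}{\partial x_i}(x)&\frac{\partial F}{\partial x_j}(x)\\ \frac1{x_i}&\frac1{x_j}\end{vmatrix}\ge0 \qquad\text{and}\qquad \begin{vmatrix}1&1&1\\ \frac{\partial F}{\partial x_i}(x)&\frac{\partial F}{\partial x_j}(x)&\frac{\partial F}{\partial x_k}(x)\\ \frac1{x_i}&\frac1{x_j}&\frac1{x_k}\end{vmatrix}\ge0 .$$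
   Context: For integers $d,r\ge 1$, the polynomial $F_{d,r}$ in $n$ variables is $$F_{d,r}(x_1,\dots,x_n)=\sum_{k_1+\dots+k_n=d,\ \max_i k_i\le r}\ \prod_{i=1}^n\frac{x_i^{k_i}}{k_i!},$$ where the $k_i$ range over nonnegative integers (so $F_{d,r}(x)$ is the coefficient of $t^d$ in $\prod_{i=1}^n\left(1+x_it+\dots+\frac{(x_it)^r}{r!}\right)$). Vertical bars denote determinants. *)

theory Defs
  imports "HOL-Analysis.Analysis"
begin

definition exponents :: "nat \<Rightarrow> nat \<Rightarrow> ('n::finite \<Rightarrow> nat) set" where
  "exponents d r = {k. (\<Sum>i\<in>UNIV. k i) = d \<and> Max (range k) \<le> r}"

definition F :: "nat \<Rightarrow> nat \<Rightarrow> real ^ 'n::finite \<Rightarrow> real" where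
  "F d r x = (\<Sum>k\<in>exponents d r. \<Prod>i\<in>UNIV. (x $ i) ^ k i / fact (k i))"

definition partial :: "'n::finite \<Rightarrow> (real ^ 'n \<Rightarrow> real) \<Rightarrow> real ^ 'n \<Rightarrow> real" where
  "partial i f x = deriv (\<lambda>t. f (\<chi> l. if l = i then t else x $ l)) (x $ i)"

definition nonneg_orthant :: "(real ^ 'n::finite) set" where
  "nonneg_orthant = {x. \<forall>i. 0 \<le> x $ i}"

text \<open>The following two facts ensure that the sum defining \<^term>\<open>F\<close> is never the default
  value of an infinite sum, and that its partial derivatives (two-sided, also on the boundary of
  the orthant) exist.\<close>

lemma finite_exponents: "finite (exponents d r :: ('n::finite \<Rightarrow> nat) set)"
proof (rule finite_subset)
  show "exponents d r \<subseteq> (PiE (UNIV :: 'n set) (\<lambda>_. {..r}))"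
    by (auto simp: exponents_def)
  show "finite (PiE (UNIV :: 'n set) (\<lambda>_. {..r}))"
    by (intro finite_PiE) auto
qed

lemma has_partial_F:
  fixes x :: "real ^ 'n::finite"
  shows "((\<lambda>t. F d r (\<chi> l. if l = i then t else x $ l))
           has_field_derivative partial i (F d r) x) (at (x $ i))"
proof -
  define g where "g l t = (if l = i then t else x $ l)" for l t
  have "(\<lambda>t. g l t) field_differentiable (at (x $ i))" for l
    unfolding g_def by (cases "l = i") simp_all
  then obtain c where c: "\<And>l. (g l has_field_derivative c l) (at (x $ i))"
    unfolding field_differentiable_def by metis
  define p where "p k l t = g l t ^ k l / fact (k l)" for k :: "'n \<Rightarrow> nat" and l t
  have "\<exists>D. (p k l has_field_derivative D) (at (x $ i))" for k l
    unfolding p_def using DERIV_cdivide[OF DERIV_power[OF c]] by blast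
  then obtain q where "\<And>k l. (p k l has_field_derivative q k l) (at (x $ i))"
    by metis
  then have "((\<lambda>t. \<Sum>k\<in>exponents d r. \<Prod>l\<in>UNIV. p k l t) has_field_derivative
      (\<Sum>k\<in>exponents d r. \<Sum>l\<in>UNIV. q k l * (\<Prod>y\<in>UNIV - {l}. p k y (x $ i)))) (at (x $ i))"
    by (intro DERIV_sum has_field_derivative_prod)
  then have "((\<lambda>t. F d r (\<chi> l. if l = i then t else x $ l)) has_field_derivative
      (\<Sum>k\<in>exponents d r. \<Sum>l\<in>UNIV. q k l * (\<Prod>y\<in>UNIV - {l}. p k y (x $ i)))) (at (x $ i))"
    unfolding p_def g_def F_def vec_lambda_beta .
  then show ?thesis
    unfolding partial_def DERIV_deriv_iff_field_differentiable field_differentiable_def ..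
qed

end

theory Submission
  imports Defs "HOL-Computational_Algebra.Polynomial"
begin

text \<open>
  Let $e(x) = \sum_{k\le r} (xt)^k/k!$, a polynomial in $t$. Then $F$ is the coefficient of $t^d$ in
  $\prod_i e(x_i)$, and differentiating with respect to $x_i$ replaces $e(x_i)$ by $t$ times its
  truncation $\bar e(x_i)$ at order $r-1$ (\<open>partial_F_eq_coeff\<close>). In each of the four inequalities, the
  factors $e(x_l)$ whose index is not involved are common to all terms and have nonnegative
  coefficients. It is therefore enough to show that a polynomial in $t$ built from two or three values
  $a \ge b \ge c \ge 0$ has nonnegative coefficients. The first inequality is then immediate.

  For the difference of two partial derivatives this polynomial is $\bar e(b)e(a) - \bar e(a)e(b)$, whose
  coefficients are nonnegative multiples of $a^r b^k - a^k b^r$ with $k < r$.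

  For the weighted partial derivatives $x_i\,\partial F/\partial x_i$, note that $a\,\bar e(a)$ is the
  derivative of $e(a)$ with respect to $t$. So the polynomial is a Wronskian of $e(a)$ and $e(b)$. Up to a
  factor $t$, its coefficients are sums of the terms $(q-s)\,a^q b^s/(q!\,s!)$ with $q,s\le r$, and exchanging
  $q$ and $s$ pairs these into terms of the right sign (\<open>nonneg_coeffs_euler_wronskian\<close>).

  The three-row determinant is the heart of the matter. With columns multiplied by $a$, $b$, $c$, it
  becomes the cyclic sum of $(c-b)\,\frac{d}{dt}e(a)\cdot e(b)\,e(c)$. It would vanish for untruncated
  exponentials, so it is governed by the truncation defects alone. Up to powers of $t$ and a factorial, it equals
  \[ a^{r+1} W(b,c) + b^{r+1} W(c,a) + c^{r+1} W(a,b), \]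
  where $W$ is the Wronskian of the two exponentials (\<open>cyclic_pderiv_trunc_exp\<close>).
  Antisymmetrizing again, the coefficients become positive combinations of $(q-s)$ times the
  $3\times3$ alternant in $a,b,c$ with exponents $r+1,q,s$. Such an alternant is nonnegative when the
  exponents decrease (\<open>alternant_nonneg\<close>), a consequence of the convexity of power functions.
\<close>


section \<open>Polynomials with nonnegative coefficients\<close>

definition nonneg_coeffs :: "real poly \<Rightarrow> bool" where
  "nonneg_coeffs p \<longleftrightarrow> (\<forall>n. 0 \<le> coeff p n)"

lemma nonneg_coeffs_mult:
  "nonneg_coeffs p \<Longrightarrow> nonneg_coeffs q \<Longrightarrow> nonneg_coeffs (p * q)"
  unfolding nonneg_coeffs_def by (auto simp: coeff_mult intro!: sum_nonneg)

lemma nonneg_coeffs_sum: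
  "(\<And>i. i \<in> A \<Longrightarrow> nonneg_coeffs (f i)) \<Longrightarrow> nonneg_coeffs (\<Sum>i\<in>A. f i)"
  unfolding nonneg_coeffs_def by (auto simp: coeff_sum intro!: sum_nonneg)

lemma nonneg_coeffs_prod:
  assumes "\<And>i. i \<in> A \<Longrightarrow> nonneg_coeffs (f i)"
  shows "nonneg_coeffs (\<Prod>i\<in>A. f i)"
  using assms
proof (induction A rule: infinite_finite_induct)
  case (insert x A)
  then show ?case by (auto intro!: nonneg_coeffs_mult)
qed (auto simp: nonneg_coeffs_def)

lemma nonneg_coeffs_monom: "0 \<le> c \<Longrightarrow> nonneg_coeffs (monom c n)"
  unfolding nonneg_coeffs_def by simp

text \<open>The Euler derivation $t\,d/dt$ preserves degrees, which makes identities simpler after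
  multiplication by a power of the variable; cancelling that power returns to the original polynomial.\<close>

lemma nonneg_coeffs_monom_cancel:
  assumes "nonneg_coeffs (monom c k * p)" and "0 < c"
  shows "nonneg_coeffs p"
  unfolding nonneg_coeffs_def
proof
  fix n
  have "0 \<le> coeff (monom c k * p) (n + k)"
    using assms(1) unfolding nonneg_coeffs_def by blast
  then show "0 \<le> coeff p n"
    using assms(2) by (simp add: coeff_monom_mult zero_le_mult_iff)
qed


section \<open>Sums and products of polynomials\<close>

lemma smult_sum_right: "smult c (\<Sum>i\<in>A. f i) = (\<Sum>i\<in>A. smult c (f i))"
  by (rule poly_eqI) (simp add: coeff_sum sum_distrib_left)

lemma pderiv_sum: "pderiv (\<Sum>i\<in>A. f i) = (\<Sum>i\<in>A. pderiv (f i))"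
  using higher_pderiv_sum[of 1 f A] by simp

lemma prod_monom: "(\<Prod>i\<in>A. monom (c i) (k i)) = monom (\<Prod>i\<in>A. c i) (\<Sum>i\<in>A. k i)"
  for c :: "'i \<Rightarrow> 'b::comm_semiring_1"
  by (induction A rule: infinite_finite_induct) (auto simp: mult_monom)


section \<open>Truncated exponentials\<close>

text \<open>The polynomial variable is the bookkeeping variable $t$ of the generating function; the point
  \<open>x\<close> only enters through the coefficients.\<close>

definition trunc_exp :: "nat \<Rightarrow> real \<Rightarrow> real poly" where
  "trunc_exp r x = (\<Sum>k\<le>r. monom (x ^ k / fact k) k)"

lemma nonneg_coeffs_trunc_exp: "0 \<le> x \<Longrightarrow> nonneg_coeffs (trunc_exp r x)"
  unfolding trunc_exp_def by (intro nonneg_coeffs_sum nonneg_coeffs_monom) simp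

lemma trunc_exp_Suc:
  "trunc_exp (Suc m) x = trunc_exp m x + monom (x ^ Suc m / fact (Suc m)) (Suc m)"
  unfolding trunc_exp_def by (rule sum.atMost_Suc)

lemma pderiv_trunc_exp: "pderiv (trunc_exp (Suc m) x) = smult x (trunc_exp m x)"
proof -
  have "pderiv (trunc_exp (Suc m) x) = (\<Sum>k\<le>Suc m. monom (real k * (x ^ k / fact k)) (k - 1))"
    unfolding trunc_exp_def pderiv_sum pderiv_monom by simp
  also have "\<dots> = (\<Sum>k\<le>m. monom (real (Suc k) * (x ^ Suc k / fact (Suc k))) k)"
    unfolding sum.atMost_Suc_shift by simp
  also have "\<dots> = (\<Sum>k\<le>m. smult x (monom (x ^ k / fact k) k))"
    by (intro sum.cong refl) (simp add: smult_monom field_simps del: of_nat_Suc)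
  finally show ?thesis
    unfolding trunc_exp_def by (simp add: smult_sum_right)
qed

text \<open>Untruncated, $e^{xt}$ satisfies $t\,\frac{d}{dt}e^{xt} = xt\,e^{xt}$. The truncation leaves
  exactly one defect, the top term of the right-hand side.\<close>

lemma euler_trunc_exp:
  "[:0, 1:] * pderiv (trunc_exp r x) = [:0, x:] * trunc_exp r x - monom (x ^ Suc r / fact r) (Suc r)"
proof (cases r)
  case 0
  then show ?thesis by (simp add: trunc_exp_def monom_Suc monom_0 pderiv_pCons)
next
  case (Suc m)
  have "trunc_exp m x = trunc_exp r x - monom (x ^ r / fact r) r"
    unfolding Suc trunc_exp_Suc by simp
  moreover have "[:0, x:] * monom (x ^ r / fact r) r = monom (x ^ Suc r / fact r) (Suc r)"
    by (simp add: monom_Suc smult_monom)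
  moreover have "[:0, 1:] * pderiv (trunc_exp r x) = [:0, x:] * trunc_exp m x"
    unfolding Suc pderiv_trunc_exp by simp
  ultimately show ?thesis
    by (simp only: right_diff_distrib)
qed


section \<open>The generating polynomial and its partial derivatives\<close>

lemma exponents_eq: "exponents d r = {k \<in> PiE UNIV (\<lambda>_. {..r}). (\<Sum>i\<in>UNIV. k i) = d}"
  by (auto simp: exponents_def)

text \<open>Choosing one summand from each truncated exponential is the same as choosing an exponent
  vector with entries at most \<open>r\<close>; its entries add up to the exponent of $t$.\<close>

lemma F_eq_coeff: "F d r x = coeff (\<Prod>i\<in>UNIV. trunc_exp r (x $ i)) d"
  for x :: "real ^ 'n::finite"
proof -
  have "(\<Prod>i\<in>(UNIV :: 'n set). trunc_exp r (x $ i))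
      = (\<Sum>k\<in>PiE UNIV (\<lambda>_. {..r}). \<Prod>i\<in>UNIV. monom ((x $ i) ^ k i / fact (k i)) (k i))"
    unfolding trunc_exp_def by (rule prod_sum_PiE) auto
  also have "\<dots> = (\<Sum>k\<in>PiE UNIV (\<lambda>_. {..r}).
      monom (\<Prod>i\<in>UNIV. (x $ i) ^ k i / fact (k i)) (\<Sum>i\<in>UNIV. k i))"
    by (simp only: prod_monom)
  finally show ?thesis
    unfolding F_def exponents_eq
    by (simp add: coeff_sum sum.inter_filter finite_PiE)
qed

text \<open>The derivative of $(xt)^k/k!$ with respect to \<open>x\<close> is $t\,(xt)^{k-1}/(k-1)!$: differentiating
  in \<open>x\<close> lowers the truncation order by one, and the extra factor $t$ lowers the index of the extracted
  coefficient by one. Writing both as successors avoids truncated subtraction.\<close>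

lemma trunc_exp_mult_has_field_derivative:
  "((\<lambda>t. coeff (trunc_exp (Suc m) t * R) (Suc n)) has_field_derivative
      coeff (trunc_exp m t * R) n) (at t)"
proof -
  define c where "c k = (if Suc n < k then 0 else coeff R (Suc n - k))" for k
  have coeff_eq: "coeff (trunc_exp (Suc m) t * R) (Suc n) = (\<Sum>k\<le>Suc m. t ^ k / fact k * c k)" for t
    unfolding trunc_exp_def sum_distrib_right coeff_sum coeff_monom_mult c_def
    by (intro sum.cong) (auto simp: not_less)
  have "((\<lambda>t. \<Sum>k\<le>Suc m. t ^ k / fact k * c k) has_field_derivative
      (\<Sum>k\<le>Suc m. real k * t ^ (k - 1) / fact k * c k)) (at t)"
    by (rule DERIV_sum) (auto intro!: derivative_eq_intros)
  also have "(\<Sum>k\<le>Suc m. real k * t ^ (k - 1) / fact k * c k) = (\<Sum>k\<le>m. t ^ k / fact k * c (Suc k))"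
    unfolding sum.atMost_Suc_shift by (simp add: add_divide_distrib[symmetric] del: of_nat_Suc)
  also have "\<dots> = coeff (trunc_exp m t * R) n"
    unfolding trunc_exp_def sum_distrib_right coeff_sum coeff_monom_mult c_def
    by (intro sum.cong) (auto simp: not_less)
  finally show ?thesis unfolding coeff_eq .
qed

lemma partial_F_eq_coeff:
  "partial i (F (Suc n) (Suc m)) x
    = coeff (trunc_exp m (x $ i) * (\<Prod>l\<in>- {i}. trunc_exp (Suc m) (x $ l))) n"
  for x :: "real ^ 'n::finite"
proof -
  define R where "R = (\<Prod>l\<in>- {i}. trunc_exp (Suc m) (x $ l))"
  have "F (Suc n) (Suc m) (\<chi> l. if l = i then t else x $ l)
      = coeff (trunc_exp (Suc m) t * R) (Suc n)" for t
  proof -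
    have "(\<Prod>l\<in>UNIV. trunc_exp (Suc m) (if l = i then t else x $ l))
        = trunc_exp (Suc m) t * (\<Prod>l\<in>UNIV - {i}. trunc_exp (Suc m) (if l = i then t else x $ l))"
      by (subst prod.remove[of _ i]) auto
    also have "(\<Prod>l\<in>UNIV - {i}. trunc_exp (Suc m) (if l = i then t else x $ l)) = R"
      unfolding R_def by (intro prod.cong) auto
    finally show ?thesis unfolding F_eq_coeff by simp
  qed
  then show ?thesis
    unfolding partial_def R_def[symmetric]
    using DERIV_imp_deriv[OF trunc_exp_mult_has_field_derivative] by simp
qed


section \<open>Inequalities between powers and alternants\<close>

lemma power_exchange_le:
  fixes a b :: real
  assumes "0 \<le> b" "b \<le> a" "s \<le> q"
  shows "a ^ s * b ^ q \<le> a ^ q * b ^ s"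
proof -
  have "(a * b) ^ s * b ^ (q - s) \<le> (a * b) ^ s * a ^ (q - s)"
    using assms by (intro mult_left_mono power_mono) auto
  then have "a ^ s * (b ^ s * b ^ (q - s)) \<le> (a ^ s * a ^ (q - s)) * b ^ s"
    by (simp add: power_mult_distrib mult_ac)
  then show ?thesis
    using assms(3) by (simp flip: power_add)
qed

text \<open>As a function of $y = x^q$, the power $x^{q+m} = y^{(q+m)/q}$ is convex, so its graph lies above
  its tangent at $y = b^q$; the inequality states this with denominators cleared. The induction on
  \<open>m\<close> avoids real exponents.\<close>

lemma power_above_tangent:
  fixes x b :: real
  assumes "0 \<le> x" "0 \<le> b"
  shows "real (q + m) * b ^ m * (x ^ q - b ^ q) \<le> real q * (x ^ (q + m) - b ^ (q + m))"
proof (induction m)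
  case (Suc m)
  have "b ^ Suc m * (x ^ q - b ^ q) \<le> real q * x ^ (q + m) * (x - b)"
  proof -
    have "b ^ Suc m * (x ^ q - b ^ q) = (\<Sum>i<q. b ^ Suc m * (b ^ (q - Suc i) * x ^ i) * (x - b))"
      by (simp add: power_diff_sumr2 sum_distrib_left sum_distrib_right mult_ac)
    \<comment> \<open>Replacing each \<open>b\<close> by \<open>x\<close> increases the term, whatever the sign of \<open>x - b\<close>.\<close>
    also have "\<dots> \<le> (\<Sum>i<q. x ^ (q + m) * (x - b))"
    proof (rule sum_mono)
      fix i assume "i \<in> {..<q}"
      then have "q + m = i + (Suc m + (q - Suc i))" by simp
      then have split: "x ^ (q + m) = x ^ i * x ^ (Suc m + (q - Suc i))"
        by (metis power_add)
      define j where "j = Suc m + (q - Suc i)"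
      have "0 \<le> (x ^ j - b ^ j) * (x - b)"
      proof (cases "b \<le> x")
        case True
        then show ?thesis using assms by (intro mult_nonneg_nonneg) (auto intro: power_mono)
      next
        case False
        then show ?thesis using assms by (intro mult_nonpos_nonpos) (auto intro: power_mono)
      qed
      then have "0 \<le> x ^ i * ((x ^ j - b ^ j) * (x - b))"
        using assms by simp
      then have "x ^ i * b ^ j * (x - b) \<le> x ^ i * x ^ j * (x - b)"
        by (simp add: algebra_simps)
      moreover have "b ^ Suc m * (b ^ (q - Suc i) * x ^ i) = x ^ i * b ^ j"
        unfolding j_def power_add by (simp only: mult_ac)
      ultimately show "b ^ Suc m * (b ^ (q - Suc i) * x ^ i) * (x - b) \<le> x ^ (q + m) * (x - b)"
        unfolding split j_def[symmetric] by (simp only:)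
    qed
    finally show ?thesis by (simp add: mult_ac)
  qed
  moreover have "b * (real (q + m) * b ^ m * (x ^ q - b ^ q)) \<le> b * (real q * (x ^ (q + m) - b ^ (q + m)))"
    using Suc.IH assms by (intro mult_left_mono)
  ultimately show ?case by (simp add: algebra_simps)
qed simp

text \<open>The $3\times3$ determinant with entries $a^p, a^q, a^s$ and likewise for \<open>b\<close> and \<open>c\<close>, expanded
  along the column of exponents \<open>p\<close>: this is the form in which it appears as a cyclic sum.\<close>

definition alternant :: "real \<Rightarrow> real \<Rightarrow> real \<Rightarrow> nat \<Rightarrow> nat \<Rightarrow> nat \<Rightarrow> real" where
  "alternant a b c p q s = a ^ p * (b ^ q * c ^ s - b ^ s * c ^ q)
     + b ^ p * (c ^ q * a ^ s - c ^ s * a ^ q) + c ^ p * (a ^ q * b ^ s - a ^ s * b ^ q)"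

lemma alternant_swap: "alternant a b c p s q = - alternant a b c p q s"
  unfolding alternant_def by (simp add: algebra_simps)

text \<open>After removing the factor $(abc)^s$, the claim compares the slopes of $x^p$ against $x^q$ (with
  the reduced exponents) on the intervals from \<open>c\<close> to \<open>b\<close> and from \<open>b\<close> to \<open>a\<close>. The tangent at \<open>b\<close>
  separates the two slopes.\<close>

lemma alternant_nonneg:
  assumes "0 \<le> c" "c \<le> b" "b \<le> a" and "s \<le> q" "q \<le> p"
  shows "0 \<le> alternant a b c p q s"
proof -
  define k m where "k = q - s" and "m = p - q"
  have q: "q = k + s" and p: "p = (k + m) + s"
    using assms unfolding k_def m_def by auto
  have factor: "alternant a b c p q s = (a * b * c) ^ s *
      ((a ^ (k + m) - b ^ (k + m)) * (b ^ k - c ^ k) - (b ^ (k + m) - c ^ (k + m)) * (a ^ k - b ^ k))"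
    unfolding alternant_def q p power_mult_distrib power_add by algebra
  have "0 \<le> (a ^ (k + m) - b ^ (k + m)) * (b ^ k - c ^ k) - (b ^ (k + m) - c ^ (k + m)) * (a ^ k - b ^ k)"
  proof (cases "k = 0")
    case False
    have "real k * (b ^ (k + m) - c ^ (k + m)) * (a ^ k - b ^ k)
        \<le> (real (k + m) * b ^ m * (b ^ k - c ^ k)) * (a ^ k - b ^ k)"
      using power_above_tangent[of c b k m] assms
      by (intro mult_right_mono) (auto simp: algebra_simps intro!: power_mono)
    also have "\<dots> = (real (k + m) * b ^ m * (a ^ k - b ^ k)) * (b ^ k - c ^ k)"
      by (simp add: mult_ac)
    also have "\<dots> \<le> (real k * (a ^ (k + m) - b ^ (k + m))) * (b ^ k - c ^ k)"
      using power_above_tangent[of a b k m] assms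
      by (intro mult_right_mono) (auto intro!: power_mono)
    finally have "real k * ((b ^ (k + m) - c ^ (k + m)) * (a ^ k - b ^ k))
        \<le> real k * ((a ^ (k + m) - b ^ (k + m)) * (b ^ k - c ^ k))"
      by (simp only: mult.assoc)
    with False show ?thesis by simp
  qed simp
  then show ?thesis
    unfolding factor using assms by simp
qed


section \<open>Wronskians of truncated exponentials\<close>

text \<open>This is the Wronskian with respect to the Euler derivation $t\,d/dt$. That derivation is
  diagonal on monomials, so a pair of monomials of degrees $q$ and $s$ contributes the factor $q-s$;
  the ordinary Wronskian carries the same information with shifted exponents.\<close>

definition euler_wronskian :: "real poly \<Rightarrow> real poly \<Rightarrow> real poly" where
  "euler_wronskian p q = [:0, 1:] * (pderiv p * q - p * pderiv q)"

text \<open>The factor $q-s$ changes sign when $q$ and $s$ are exchanged, so only the antisymmetric part of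
  \<open>g\<close> contributes. Positivity can fail for the individual terms of the first sum, but it
  holds for those of the second if \<open>w\<close> is nonnegative and $g(q,s)-g(s,q)$ has the sign of $q-s$.\<close>

lemma double_sum_antisymmetrize:
  fixes w :: "nat \<Rightarrow> nat \<Rightarrow> real" and g :: "nat \<Rightarrow> nat \<Rightarrow> real"
  assumes "\<And>q s. w s q = w q s"
  shows "(\<Sum>q\<le>r. \<Sum>s\<le>r. monom ((real q - real s) * w q s * g q s) (q + s))
    = (\<Sum>q\<le>r. \<Sum>s\<le>r. monom ((real q - real s) * w q s * ((g q s - g s q) / 2)) (q + s))"
    (is "?L = ?R")
proof -
  have swap: "?L = (\<Sum>q\<le>r. \<Sum>s\<le>r. monom ((real s - real q) * w q s * g s q) (q + s))"
    by (subst sum.swap) (simp add: assms add.commute)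
  have "?L = smult (1/2) (?L + ?L)"
    by (simp only: smult_add_right smult_add_left[symmetric]) simp
  also have "?L + ?L = (\<Sum>q\<le>r. \<Sum>s\<le>r. monom ((real q - real s) * w q s * (g q s - g s q)) (q + s))"
    by (subst (2) swap) (simp add: sum.distrib[symmetric] add_monom algebra_simps)
  also have "smult (1/2) \<dots> = ?R"
    by (simp add: smult_sum_right smult_monom)
  finally show ?thesis .
qed

lemma euler_wronskian_trunc_exp:
  "euler_wronskian (trunc_exp r b) (trunc_exp r c)
    = (\<Sum>q\<le>r. \<Sum>s\<le>r. monom ((real q - real s) * (1 / (fact q * fact s)) * (b ^ q * c ^ s)) (q + s))"
proof -
  have euler: "[:0, 1:] * pderiv (trunc_exp r x) = (\<Sum>k\<le>r. monom (real k * (x ^ k / fact k)) k)" for x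
  proof -
    have "[:0, 1:] * monom (real k * (x ^ k / fact k)) (k - 1) = monom (real k * (x ^ k / fact k)) k" for k
      by (cases k) (simp_all add: monom_Suc)
    then show ?thesis
      unfolding trunc_exp_def pderiv_sum pderiv_monom sum_distrib_left by simp
  qed
  have "euler_wronskian (trunc_exp r b) (trunc_exp r c)
      = ([:0, 1:] * pderiv (trunc_exp r b)) * trunc_exp r c
        - trunc_exp r b * ([:0, 1:] * pderiv (trunc_exp r c))"
    unfolding euler_wronskian_def by (simp only: algebra_simps)
  also have "\<dots> = (\<Sum>q\<le>r. \<Sum>s\<le>r. monom (real q * (b ^ q / fact q)) q * monom (c ^ s / fact s) s
        - monom (b ^ q / fact q) q * monom (real s * (c ^ s / fact s)) s)"
    unfolding euler unfolding trunc_exp_def sum_product sum_subtractf ..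
  also have "\<dots> = (\<Sum>q\<le>r. \<Sum>s\<le>r.
      monom ((real q - real s) * (1 / (fact q * fact s)) * (b ^ q * c ^ s)) (q + s))"
    by (intro sum.cong refl) (simp add: mult_monom diff_monom field_simps)
  finally show ?thesis .
qed

lemma nonneg_coeffs_euler_wronskian:
  assumes "0 \<le> b" "b \<le> a"
  shows "nonneg_coeffs (euler_wronskian (trunc_exp r a) (trunc_exp r b))"
proof -
  have "0 \<le> (real q - real s) * (1 / (fact q * fact s)) * ((a ^ q * b ^ s - a ^ s * b ^ q) / 2)" for q s
  proof (cases "s \<le> q")
    case True
    with power_exchange_le[OF assms True] show ?thesis by simp
  next
    case False
    with power_exchange_le[OF assms, of q s] show ?thesis
      by (intro mult_nonpos_nonpos) (simp_all add: divide_simps)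
  qed
  then show ?thesis
    unfolding euler_wronskian_trunc_exp
    by (subst double_sum_antisymmetrize) (auto intro!: nonneg_coeffs_sum nonneg_coeffs_monom)
qed

text \<open>Antisymmetrizing the cyclic sum turns its coefficients into alternants with exponents
  $p$, $q$, $s$. Since $p$ is at least the truncation order, it is the largest of the three, and the
  sign of the alternant is the sign of $q-s$.\<close>

lemma nonneg_coeffs_cyclic_wronskian:
  assumes "0 \<le> c" "c \<le> b" "b \<le> a" "r \<le> p"
  shows "nonneg_coeffs
    (smult (a ^ p) (euler_wronskian (trunc_exp r b) (trunc_exp r c))
     + smult (b ^ p) (euler_wronskian (trunc_exp r c) (trunc_exp r a))
     + smult (c ^ p) (euler_wronskian (trunc_exp r a) (trunc_exp r b)))" (is "nonneg_coeffs ?P")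
proof -
  define g where "g q s = a ^ p * (b ^ q * c ^ s) + b ^ p * (c ^ q * a ^ s) + c ^ p * (a ^ q * b ^ s)" for q s
  have alt: "g q s - g s q = alternant a b c p q s" for q s
    unfolding g_def alternant_def by (simp add: algebra_simps)
  have "?P = (\<Sum>q\<le>r. \<Sum>s\<le>r. monom ((real q - real s) * (1 / (fact q * fact s)) * g q s) (q + s))"
    unfolding euler_wronskian_trunc_exp g_def smult_sum_right smult_monom sum.distrib[symmetric] add_monom
    by (intro sum.cong refl arg_cong2[where f = monom]) (simp add: algebra_simps)
  also have "\<dots> = (\<Sum>q\<le>r. \<Sum>s\<le>r.
      monom ((real q - real s) * (1 / (fact q * fact s)) * (alternant a b c p q s / 2)) (q + s))"
    unfolding alt[symmetric] by (rule double_sum_antisymmetrize) simp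
  finally have P: "?P = \<dots>" .
  have "0 \<le> (real q - real s) * (1 / (fact q * fact s)) * (alternant a b c p q s / 2)"
    if "q \<le> r" "s \<le> r" for q s
  proof (cases "s \<le> q")
    case True
    then show ?thesis using alternant_nonneg[OF assms(1-3) True, of p] that assms by simp
  next
    case False
    then have "0 \<le> alternant a b c p s q"
      using alternant_nonneg[OF assms(1-3), of q s p] that assms by simp
    then show ?thesis using False alternant_swap[of a b c p s q]
      by (intro mult_nonpos_nonpos) (simp_all add: divide_simps)
  qed
  then show ?thesis
    unfolding P by (auto intro!: nonneg_coeffs_sum nonneg_coeffs_monom)
qed

text \<open>For untruncated exponentials the left-hand side would vanish, because then each derivative is
  the function times $a$, $b$ or $c$ and $(c-b)a+(a-c)b+(b-a)c=0$. So only the truncation defects of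
  \<open>euler_trunc_exp\<close> survive, and they carry the powers $a^{r+1}$, $b^{r+1}$, $c^{r+1}$. They come with products
  such as $(b-c)\,e(b)\,e(c)$, which equal Wronskians up to further defects; in the cyclic sum these
  second-order defects cancel in pairs.\<close>

lemma cyclic_pderiv_trunc_exp:
  fixes a b c :: real and r :: nat
  defines "e \<equiv> trunc_exp r"
  shows "monom (fact r) 2 *
      (smult (c - b) (pderiv (e a) * e b * e c) + smult (a - c) (pderiv (e b) * e c * e a)
        + smult (b - a) (pderiv (e c) * e a * e b))
    = monom 1 (Suc r) *
      (smult (a ^ Suc r) (euler_wronskian (e b) (e c)) + smult (b ^ Suc r) (euler_wronskian (e c) (e a))
        + smult (c ^ Suc r) (euler_wronskian (e a) (e b)))"
proof -
  define X M f where "X = ([:0, 1:] :: real poly)" and "M = monom (1::real) (Suc r)"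
    and "f = [:(fact r :: real):]"
  define A B C where "A = [:a:]" and "B = [:b:]" and "C = [:c:]"
  define A' B' C' where "A' = [:a ^ Suc r:]" and "B' = [:b ^ Suc r:]" and "C' = [:c ^ Suc r:]"
  have key: "f * (X * pderiv (e x)) = f * (X * [:x:] * e x) - [:x ^ Suc r:] * M" for x
  proof -
    have "X * pderiv (e x) = X * [:x:] * e x - monom (x ^ Suc r / fact r) (Suc r)"
      unfolding X_def e_def using euler_trunc_exp[of r x] by simp
    moreover have "f * monom (x ^ Suc r / fact r) (Suc r) = [:x ^ Suc r:] * M"
      by (simp add: f_def M_def smult_monom)
    ultimately show ?thesis by (simp add: right_diff_distrib)
  qed
  \<comment> \<open>Multiplying by the constant polynomial \<open>f\<close> clears the factorial from the truncation defects,
    so that the claim follows by ring arithmetic alone; the surplus \<open>f\<close> is cancelled at the end.\<close>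
  note keys = key[of a, folded A_def A'_def] key[of b, folded B_def B'_def] key[of c, folded C_def C'_def]
  have "f \<noteq> 0" by (simp add: f_def)
  have "f * (f * X^2 * ((C - B) * (pderiv (e a) * e b * e c) + (A - C) * (pderiv (e b) * e c * e a)
        + (B - A) * (pderiv (e c) * e a * e b)))
     = f * (M * (A' * (X * (pderiv (e b) * e c - e b * pderiv (e c)))
        + B' * (X * (pderiv (e c) * e a - e c * pderiv (e a)))
        + C' * (X * (pderiv (e a) * e b - e a * pderiv (e b)))))"
    using keys by algebra
  then have "f * X^2 * ((C - B) * (pderiv (e a) * e b * e c) + (A - C) * (pderiv (e b) * e c * e a)
        + (B - A) * (pderiv (e c) * e a * e b))
     = M * (A' * (X * (pderiv (e b) * e c - e b * pderiv (e c)))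
        + B' * (X * (pderiv (e c) * e a - e c * pderiv (e a)))
        + C' * (X * (pderiv (e a) * e b - e a * pderiv (e b))))"
    using \<open>f \<noteq> 0\<close> by simp
  moreover have "f * X^2 = monom (fact r) 2"
    by (simp add: f_def X_def numeral_2_eq_2 monom_Suc monom_0)
  moreover have "C - B = [:c - b:]" "A - C = [:a - c:]" "B - A = [:b - a:]"
    by (simp_all add: A_def B_def C_def)
  ultimately show ?thesis
    unfolding euler_wronskian_def X_def[symmetric] M_def[symmetric] A'_def B'_def C'_def by simp
qed

lemma nonneg_coeffs_cyclic_pderiv:
  assumes "0 \<le> c" "c \<le> b" "b \<le> a"
  shows "nonneg_coeffs
    (smult (c - b) (pderiv (trunc_exp r a) * trunc_exp r b * trunc_exp r c)
     + smult (a - c) (pderiv (trunc_exp r b) * trunc_exp r c * trunc_exp r a)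
     + smult (b - a) (pderiv (trunc_exp r c) * trunc_exp r a * trunc_exp r b))"
  by (rule nonneg_coeffs_monom_cancel[where c = "fact r" and k = 2])
     (simp_all only: cyclic_pderiv_trunc_exp nonneg_coeffs_mult nonneg_coeffs_monom
        nonneg_coeffs_cyclic_wronskian[OF assms] fact_gt_zero zero_le_one le_SucI order_refl)


section \<open>Comparing the partial derivatives\<close>

text \<open>The products of the two lower truncations cancel; what remains pairs the top term of one
  factor with the lower terms of the other, and the larger base gains from the larger
  exponent.\<close>

lemma nonneg_coeffs_cross_difference:
  assumes "0 \<le> b" "b \<le> a"
  shows "nonneg_coeffs (trunc_exp m b * trunc_exp (Suc m) a - trunc_exp m a * trunc_exp (Suc m) b)"
proof -
  have "trunc_exp m b * trunc_exp (Suc m) a - trunc_exp m a * trunc_exp (Suc m) b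
      = trunc_exp m b * monom (a ^ Suc m / fact (Suc m)) (Suc m)
        - trunc_exp m a * monom (b ^ Suc m / fact (Suc m)) (Suc m)"
    unfolding trunc_exp_Suc by (simp only: algebra_simps)
  also have "\<dots> = (\<Sum>k\<le>m. monom ((a ^ Suc m * b ^ k - a ^ k * b ^ Suc m) / (fact k * fact (Suc m))) (k + Suc m))"
    unfolding trunc_exp_def sum_distrib_right sum_subtractf[symmetric] mult_monom diff_monom
    by (intro sum.cong refl arg_cong2[where f = monom]) (simp add: diff_divide_distrib mult_ac)
  finally show ?thesis
    using power_exchange_le[OF assms, of _ "Suc m"]
    by (auto intro!: nonneg_coeffs_sum nonneg_coeffs_monom divide_nonneg_nonneg simp del: power_Suc fact_Suc)
qed

lemma nonneg_coeffs_prod_trunc_exp: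
  assumes "x \<in> nonneg_orthant"
  shows "nonneg_coeffs (\<Prod>l\<in>A. trunc_exp r (x $ l))"
  using assms by (auto intro!: nonneg_coeffs_prod nonneg_coeffs_trunc_exp simp: nonneg_orthant_def)

lemma partial_F_nonneg:
  assumes "x \<in> nonneg_orthant"
  shows "0 \<le> partial i (F (Suc n) (Suc m)) x"
  using nonneg_coeffs_mult[OF nonneg_coeffs_trunc_exp nonneg_coeffs_prod_trunc_exp[OF assms]] assms
  unfolding partial_F_eq_coeff nonneg_coeffs_def nonneg_orthant_def by blast

text \<open>To compare the partial derivatives at two indices, the factors belonging to both are split off;
  the remaining product is common to the two and has nonnegative coefficients.\<close>

lemma partial_F_eq_coeff2:
  fixes x :: "real ^ 'n::finite"
  assumes "i \<noteq> j"
  shows "partial i (F (Suc n) (Suc m)) x = coeff (trunc_exp m (x $ i) * trunc_exp (Suc m) (x $ j)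
    * (\<Prod>l\<in>- {i, j}. trunc_exp (Suc m) (x $ l))) n"
proof -
  have "- {i} = insert j (- {i, j})" using assms by auto
  then show ?thesis unfolding partial_F_eq_coeff by (simp add: mult.assoc)
qed

lemma partial_F_antimono:
  fixes x :: "real ^ 'n::finite"
  assumes x: "x \<in> nonneg_orthant" and le: "x $ j \<le> x $ i"
  shows "partial i (F (Suc n) (Suc m)) x \<le> partial j (F (Suc n) (Suc m)) x"
proof (cases "i = j")
  case False
  define R where "R = (\<Prod>l\<in>- {i, j}. trunc_exp (Suc m) (x $ l))"
  have R: "(\<Prod>l\<in>- {j, i}. trunc_exp (Suc m) (x $ l)) = R"
    unfolding R_def by (simp only: insert_commute)
  have "nonneg_coeffs ((trunc_exp m (x $ j) * trunc_exp (Suc m) (x $ i)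
      - trunc_exp m (x $ i) * trunc_exp (Suc m) (x $ j)) * R)"
    using x le unfolding R_def
    by (intro nonneg_coeffs_mult nonneg_coeffs_cross_difference nonneg_coeffs_prod_trunc_exp)
       (auto simp: nonneg_orthant_def)
  then have "0 \<le> coeff (trunc_exp m (x $ j) * trunc_exp (Suc m) (x $ i) * R
      - trunc_exp m (x $ i) * trunc_exp (Suc m) (x $ j) * R) n"
    unfolding nonneg_coeffs_def left_diff_distrib by blast
  then show ?thesis
    unfolding partial_F_eq_coeff2[OF False] partial_F_eq_coeff2[OF False[symmetric]] R
    unfolding R_def[symmetric] by simp
qed simp

text \<open>The factor $x_i$ turns the lowered truncation \<open>trunc_exp m (x $ i)\<close> into the derivative of the full
  one with respect to $t$, so the difference of the two sides is a coefficient of a Wronskian.\<close>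

lemma weighted_partial_F_mono:
  fixes x :: "real ^ 'n::finite"
  assumes x: "x \<in> nonneg_orthant" and le: "x $ j \<le> x $ i"
  shows "x $ j * partial j (F (Suc n) (Suc m)) x \<le> x $ i * partial i (F (Suc n) (Suc m)) x"
proof (cases "i = j")
  case False
  define R where "R = (\<Prod>l\<in>- {i, j}. trunc_exp (Suc m) (x $ l))"
  have R: "(\<Prod>l\<in>- {j, i}. trunc_exp (Suc m) (x $ l)) = R"
    unfolding R_def by (simp only: insert_commute)
  define e where "e l = trunc_exp (Suc m) (x $ l)" for l
  have "nonneg_coeffs (monom 1 1 * (pderiv (e i) * e j - e i * pderiv (e j)))"
    using nonneg_coeffs_euler_wronskian[of "x $ j" "x $ i" "Suc m"] x le
    unfolding euler_wronskian_def e_def nonneg_orthant_def by (simp add: monom_Suc monom_0)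
  then have "nonneg_coeffs (pderiv (e i) * e j - e i * pderiv (e j))"
    by (rule nonneg_coeffs_monom_cancel) simp
  then have "nonneg_coeffs ((pderiv (e i) * e j - e i * pderiv (e j)) * R)"
    unfolding R_def by (intro nonneg_coeffs_mult nonneg_coeffs_prod_trunc_exp x)
  then have "0 \<le> coeff (pderiv (e i) * e j * R - pderiv (e j) * e i * R) n"
    unfolding nonneg_coeffs_def by (simp only: left_diff_distrib mult.commute[of "e i"])
  then show ?thesis
    unfolding partial_F_eq_coeff2[OF False] partial_F_eq_coeff2[OF False[symmetric]] R
    unfolding R_def[symmetric] e_def pderiv_trunc_exp by simp
qed simp

lemma weighted_partial_F_eq_coeff3:
  fixes x :: "real ^ 'n::finite"
  assumes "i \<noteq> j" "i \<noteq> k" "j \<noteq> k"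
  shows "x $ i * partial i (F (Suc n) (Suc m)) x
    = coeff (pderiv (trunc_exp (Suc m) (x $ i)) * trunc_exp (Suc m) (x $ j) * trunc_exp (Suc m) (x $ k)
        * (\<Prod>l\<in>- {i, j, k}. trunc_exp (Suc m) (x $ l))) n"
proof -
  have "- {i} = insert j (insert k (- {i, j, k}))" using assms by auto
  then show ?thesis unfolding partial_F_eq_coeff pderiv_trunc_exp
    using assms by (simp add: mult.assoc)
qed

text \<open>The combination is the three-row determinant after its columns are multiplied by $x_i$, $x_j$, $x_k$
  and it is expanded along the row of partial derivatives. The indices must be distinct for the
  three factors to be split off from the generating polynomial.\<close>

lemma cyclic_weighted_partial_F_nonneg:
  fixes x :: "real ^ 'n::finite" and m n :: nat
  assumes x: "x \<in> nonneg_orthant" and le: "x $ k \<le> x $ j" "x $ j \<le> x $ i"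
    and distinct: "i \<noteq> j" "i \<noteq> k" "j \<noteq> k"
  defines "D \<equiv> \<lambda>l. x $ l * partial l (F (Suc n) (Suc m)) x"
  shows "0 \<le> (x $ k - x $ j) * D i + (x $ i - x $ k) * D j + (x $ j - x $ i) * D k"
proof -
  define R where "R = (\<Prod>l\<in>- {i, j, k}. trunc_exp (Suc m) (x $ l))"
  define e where "e l = trunc_exp (Suc m) (x $ l)" for l
  have D: "D i = coeff (pderiv (e i) * e j * e k * R) n"
    "D j = coeff (pderiv (e j) * e k * e i * R) n"
    "D k = coeff (pderiv (e k) * e i * e j * R) n"
  proof -
    have "{j, k, i} = {i, j, k}" "{k, i, j} = {i, j, k}" by auto
    then show "D i = coeff (pderiv (e i) * e j * e k * R) n"
      "D j = coeff (pderiv (e j) * e k * e i * R) n"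
      "D k = coeff (pderiv (e k) * e i * e j * R) n"
      using weighted_partial_F_eq_coeff3[of i j k] weighted_partial_F_eq_coeff3[of j k i]
        weighted_partial_F_eq_coeff3[of k i j] distinct
      unfolding D_def e_def R_def by simp_all
  qed
  have "nonneg_coeffs ((smult (x $ k - x $ j) (pderiv (e i) * e j * e k)
      + smult (x $ i - x $ k) (pderiv (e j) * e k * e i)
      + smult (x $ j - x $ i) (pderiv (e k) * e i * e j)) * R)"
    using x le unfolding R_def e_def
    by (intro nonneg_coeffs_mult nonneg_coeffs_cyclic_pderiv nonneg_coeffs_prod_trunc_exp)
       (auto simp: nonneg_orthant_def)
  then have "0 \<le> coeff ((smult (x $ k - x $ j) (pderiv (e i) * e j * e k)
      + smult (x $ i - x $ k) (pderiv (e j) * e k * e i)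
      + smult (x $ j - x $ i) (pderiv (e k) * e i * e j)) * R) n"
    unfolding nonneg_coeffs_def by blast
  then show ?thesis
    unfolding D by (simp only: distrib_right mult_smult_left coeff_add coeff_smult)
qed


section \<open>The determinant inequalities\<close>

lemma det_cleared_reciprocals:
  fixes a b c u v w :: real
  assumes "a \<noteq> 0" "b \<noteq> 0" "c \<noteq> 0"
  shows "det (vector [vector [1, 1, 1], vector [u, v, w], vector [1 / a, 1 / b, 1 / c]] :: real ^ 3 ^ 3)
    = ((c - b) * (a * u) + (a - c) * (b * v) + (b - a) * (c * w)) / (a * b * c)"
  using assms by (simp add: det_3 vector_3 field_simps)

theorem lemma13:
  fixes d r :: nat
  assumes "d \<ge> 1" and "r \<ge> 1"
  shows
    "(\<forall>i. \<forall>x \<in> (nonneg_orthant :: (real ^ 'n::finite) set). partial i (F d r) x \<ge> 0) \<and>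
     (\<forall>x \<in> (nonneg_orthant :: (real ^ 'n) set). \<forall>i j. x $ i \<ge> x $ j \<longrightarrow>
        det (vector
          [vector [1, 1],
           vector [partial i (F d r) x, partial j (F d r) x]] :: real ^ 2 ^ 2) \<ge> 0) \<and>
     (\<forall>i j k. \<forall>x \<in> (nonneg_orthant :: (real ^ 'n) set).
        x $ i \<ge> x $ j \<and> x $ j \<ge> x $ k \<and> x $ k > 0 \<longrightarrow>
        det (vector
          [vector [partial i (F d r) x, partial j (F d r) x],
           vector [1 / x $ i, 1 / x $ j]] :: real ^ 2 ^ 2) \<ge> 0 \<and>
        det (vector
          [vector [1, 1, 1],
           vector [partial i (F d r) x, partial j (F d r) x, partial k (F d r) x],
           vector [1 / x $ i, 1 / x $ j, 1 / x $ k]] :: real ^ 3 ^ 3) \<ge> 0)"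
proof -
  obtain n m where dr: "d = Suc n" "r = Suc m"
    using assms by (metis Suc_le_D One_nat_def)
  show ?thesis
    unfolding dr
  proof (intro conjI allI ballI impI)
    show "0 \<le> partial i (F (Suc n) (Suc m)) x" if "x \<in> nonneg_orthant" for i and x :: "real ^ 'n"
      using that by (rule partial_F_nonneg)
  next
    fix x :: "real ^ 'n" and i j
    assume "x \<in> nonneg_orthant" "x $ i \<ge> x $ j"
    then show "det (vector [vector [1, 1],
        vector [partial i (F (Suc n) (Suc m)) x, partial j (F (Suc n) (Suc m)) x]] :: real ^ 2 ^ 2) \<ge> 0"
      using partial_F_antimono by (simp add: det_2 vector_2)
  next
    fix x :: "real ^ 'n" and i j k
    assume x: "x \<in> nonneg_orthant" and le: "x $ i \<ge> x $ j \<and> x $ j \<ge> x $ k \<and> x $ k > 0"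
    then show "det (vector [vector [partial i (F (Suc n) (Suc m)) x, partial j (F (Suc n) (Suc m)) x],
        vector [1 / x $ i, 1 / x $ j]] :: real ^ 2 ^ 2) \<ge> 0"
      using weighted_partial_F_mono[OF x, of j i n m] by (simp add: det_2 vector_2 field_simps)
  next
    fix x :: "real ^ 'n" and i j k
    assume x: "x \<in> nonneg_orthant" and le: "x $ i \<ge> x $ j \<and> x $ j \<ge> x $ k \<and> x $ k > 0"
    then have pos: "x $ i > 0" "x $ j > 0" "x $ k > 0" by auto
    have "0 \<le> (x $ k - x $ j) * (x $ i * partial i (F (Suc n) (Suc m)) x)
        + (x $ i - x $ k) * (x $ j * partial j (F (Suc n) (Suc m)) x)
        + (x $ j - x $ i) * (x $ k * partial k (F (Suc n) (Suc m)) x)"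
    proof (cases "i \<noteq> j \<and> i \<noteq> k \<and> j \<noteq> k")
      case True
      with cyclic_weighted_partial_F_nonneg[OF x] le show ?thesis by blast
    next
      \<comment> \<open>Two equal indices give two equal columns.\<close>
      case False
      then show ?thesis by (auto simp: algebra_simps)
    qed
    with pos show "det (vector [vector [1, 1, 1],
        vector [partial i (F (Suc n) (Suc m)) x, partial j (F (Suc n) (Suc m)) x, partial k (F (Suc n) (Suc m)) x],
        vector [1 / x $ i, 1 / x $ j, 1 / x $ k]] :: real ^ 3 ^ 3) \<ge> 0"
      by (subst det_cleared_reciprocals) auto
  qed
qed

end
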